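(* Let $\mathcal{C}$ be a category with finite products, viewed as a symmetric monoidal category under $\times$. Then the category $\mathbf{Optic}_{\mathcal{C}}$, restricted to optics of shape $(S,S)\to(A,A)$ (i.e. its full subcategory on objects of the form $(S,S)$), is the category of lenses in $\mathcal{C}$; that is, it is isomorphic to the category of lenses by an isomorphism sending $(S,S)$ to $S$.
   Context: The category of lenses in $\mathcal{C}$: objects are the objects of $\mathcal{C}$; a morphism $S\to A$ is a pair of morphisms $\mathrm{Get}:S\to A$ and $\mathrm{Put}:S\times A\to S$ of $\mathcal{C}$ (no laws imposed). The composite of $(\mathrm{Get}_1,\mathrm{Put}_1):T\to S$ and $(\mathrm{Get}_2,\mathrm{Put}_2):S\to A$ has $$\mathrm{Get}:T\xrightarrow{\mathrm{Get}_1}S\xrightarrow{\mathrm{Get}_2}A,\qquad \mathrm{Put}:T\times A\xrightarrow{[\mathrm{id}_T,\mathrm{Get}_1]\times A}T\times S\times A\xrightarrow{T\times\mathrm{Put}_2}T\times S\xrightarrow{\mathrm{Put}_1}T,$$ where $[f,g]$ denotes pairing into a product and an object denotes its identity; the identity on $S$ is $(\mathrm{id}_S,\pi_2)$... with $\pi_2:S\times S\to S$ the second projection. The category $\mathbf{Optic}_{\mathcal{C}}$: objects are pairs $(S,S')$ of objects of $\mathcal{C}$; $\mathbf{Optic}_{\mathcal{C}}((S,S'),(A,A')):=\int^{M\in\mathcal{C}}\mathcal{C}(S,M\times A)\times\mathcal{C}(M\times A',S')$, i.e. pairs $(l:S\to M\times A,\ r:M\times A'\to S')$ for some $M$ (the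 residual), modulo the equivalence relation generated by $((f\times A)l,r)\sim(l,r(f\times A'))$ for $f:M\to N$, $l:S\to M\times A$, $r:N\times A'\to S'$; the class of $(l,r)$ is $\langle l\mid r\rangle$. Identities are $\langle\lambda_S^{-1}\mid\lambda_{S'}\rangle$ with $\lambda_S:1\times S\to S$ the unitor; composition is $\langle l\mid r\rangle\circ\langle l'\mid r'\rangle=\langle(M\times l)l'\mid r'(M\times r)\rangle$, where $M$ is the residual of $\langle l'\mid r'\rangle$ (associativity isomorphisms suppressed). *)

theory Defs
  imports Main
begin

section \<open>Categories and functors\<close>

record ('o, 'm) category_data =
  Obj :: "'o set"
  Arr :: "'m set"
  Dom :: "'m \<Rightarrow> 'o"
  Cod :: "'m \<Rightarrow> 'o"
  Ident :: "'o \<Rightarrow> 'm"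
  Comp :: "'m \<Rightarrow> 'm \<Rightarrow> 'm"  (infixr "\<cdot>\<index>" 70)

definition Hom :: "('o, 'm, 'x) category_data_scheme \<Rightarrow> 'o \<Rightarrow> 'o \<Rightarrow> 'm set" where
  "Hom C X Y = {f \<in> Arr C. Dom C f = X \<and> Cod C f = Y}"

locale category =
  fixes C :: "('o, 'm, 'x) category_data_scheme" (structure)
  assumes Dom_in: "f \<in> Arr C \<Longrightarrow> Dom C f \<in> Obj C"
    and Cod_in: "f \<in> Arr C \<Longrightarrow> Cod C f \<in> Obj C"
    and Ident_in: "X \<in> Obj C \<Longrightarrow> Ident C X \<in> Hom C X X"
    and Comp_in: "f \<in> Hom C X Y \<Longrightarrow> g \<in> Hom C Y Z \<Longrightarrow> g \<cdot> f \<in> Hom C X Z"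
    and Comp_Ident: "f \<in> Hom C X Y \<Longrightarrow> f \<cdot> Ident C X = f"
    and Ident_Comp: "f \<in> Hom C X Y \<Longrightarrow> Ident C Y \<cdot> f = f"
    and Comp_assoc: "f \<in> Hom C W X \<Longrightarrow> g \<in> Hom C X Y \<Longrightarrow> h \<in> Hom C Y Z
      \<Longrightarrow> (h \<cdot> g) \<cdot> f = h \<cdot> (g \<cdot> f)"

locale cat_functor = source: category C + target: category D
  for C :: "('o1, 'm1, 'x1) category_data_scheme"
    and D :: "('o2, 'm2, 'x2) category_data_scheme" +
  fixes Fo :: "'o1 \<Rightarrow> 'o2" and Fa :: "'m1 \<Rightarrow> 'm2"
  assumes Fo_in: "X \<in> Obj C \<Longrightarrow> Fo X \<in> Obj D"
    and Fa_in: "f \<in> Hom C X Y \<Longrightarrow> Fa f \<in> Hom D (Fo X) (Fo Y)"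
    and Fa_Ident: "X \<in> Obj C \<Longrightarrow> Fa (Ident C X) = Ident D (Fo X)"
    and Fa_Comp: "f \<in> Hom C X Y \<Longrightarrow> g \<in> Hom C Y Z
      \<Longrightarrow> Fa (g \<cdot>\<^bsub>C\<^esub> f) = Fa g \<cdot>\<^bsub>D\<^esub> Fa f"

definition cat_isomorphism ::
  "('o1, 'm1, 'x1) category_data_scheme \<Rightarrow> ('o2, 'm2, 'x2) category_data_scheme
    \<Rightarrow> ('o1 \<Rightarrow> 'o2) \<Rightarrow> ('m1 \<Rightarrow> 'm2) \<Rightarrow> bool" where
  "cat_isomorphism C D Fo Fa \<longleftrightarrow> cat_functor C D Fo Fa \<and>
    (\<exists>Go Ga. cat_functor D C Go Ga \<and>
      (\<forall>X\<in>Obj C. Go (Fo X) = X) \<and> (\<forall>f\<in>Arr C. Ga (Fa f) = f) \<and>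
      (\<forall>Y\<in>Obj D. Fo (Go Y) = Y) \<and> (\<forall>g\<in>Arr D. Fa (Ga g) = g))"

definition full_subcategory ::
  "('o, 'm, 'x) category_data_scheme \<Rightarrow> 'o set \<Rightarrow> ('o, 'm, 'x) category_data_scheme" where
  "full_subcategory C U =
    C\<lparr>Obj := Obj C \<inter> U, Arr := {f \<in> Arr C. Dom C f \<in> U \<and> Cod C f \<in> U}\<rparr>"

definition inverse_arrow :: "('o, 'm, 'x) category_data_scheme \<Rightarrow> 'm \<Rightarrow> 'm" where
  "inverse_arrow C f = (THE g. g \<in> Hom C (Cod C f) (Dom C f) \<and>
    g \<cdot>\<^bsub>C\<^esub> f = Ident C (Dom C f) \<and> f \<cdot>\<^bsub>C\<^esub> g = Ident C (Cod C f))"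


section \<open>Finite products\<close>

text \<open>Finite products are given as a chosen terminal object together with chosen binary
  products and their projections.\<close>

record ('o, 'm) product_data = "('o, 'm) category_data" +
  Unit :: 'o
  Prod :: "'o \<Rightarrow> 'o \<Rightarrow> 'o"  (infixr "\<otimes>\<index>" 75)
  Pr1 :: "'o \<Rightarrow> 'o \<Rightarrow> 'm"
  Pr2 :: "'o \<Rightarrow> 'o \<Rightarrow> 'm"

locale category_with_finite_products = category C
  for C :: "('o, 'm, 'x) product_data_scheme" (structure) +
  assumes Unit_in: "Unit C \<in> Obj C"
    and Unit_terminal: "X \<in> Obj C \<Longrightarrow> \<exists>!t. t \<in> Hom C X (Unit C)"
    and Prod_in: "A \<in> Obj C \<Longrightarrow> B \<in> Obj C \<Longrightarrow> A \<otimes> B \<in> Obj C"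
    and Pr1_in: "A \<in> Obj C \<Longrightarrow> B \<in> Obj C \<Longrightarrow> Pr1 C A B \<in> Hom C (A \<otimes> B) A"
    and Pr2_in: "A \<in> Obj C \<Longrightarrow> B \<in> Obj C \<Longrightarrow> Pr2 C A B \<in> Hom C (A \<otimes> B) B"
    and Prod_universal: "f \<in> Hom C X A \<Longrightarrow> g \<in> Hom C X B
      \<Longrightarrow> \<exists>!h. h \<in> Hom C X (A \<otimes> B) \<and> Pr1 C A B \<cdot> h = f \<and> Pr2 C A B \<cdot> h = g"

definition pairing :: "('o, 'm, 'x) product_data_scheme \<Rightarrow> 'm \<Rightarrow> 'm \<Rightarrow> 'm" where
  "pairing C f g = (THE h. h \<in> Hom C (Dom C f) (Cod C f \<otimes>\<^bsub>C\<^esub> Cod C g) \<and>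
    Pr1 C (Cod C f) (Cod C g) \<cdot>\<^bsub>C\<^esub> h = f \<and> Pr2 C (Cod C f) (Cod C g) \<cdot>\<^bsub>C\<^esub> h = g)"

definition prod_arrow :: "('o, 'm, 'x) product_data_scheme \<Rightarrow> 'm \<Rightarrow> 'm \<Rightarrow> 'm"
    (infixr "\<times>\<index>" 75) where
  "f \<times>\<^bsub>C\<^esub> g =
    pairing C (f \<cdot>\<^bsub>C\<^esub> Pr1 C (Dom C f) (Dom C g)) (g \<cdot>\<^bsub>C\<^esub> Pr2 C (Dom C f) (Dom C g))"

definition associator :: "('o, 'm, 'x) product_data_scheme \<Rightarrow> 'o \<Rightarrow> 'o \<Rightarrow> 'o \<Rightarrow> 'm" where
  \<comment> \<open>\<open>(X \<otimes> Y) \<otimes> Z \<rightarrow> X \<otimes> (Y \<otimes> Z)\<close>\<close>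
  "associator C X Y Z =
    pairing C (Pr1 C X Y \<cdot>\<^bsub>C\<^esub> Pr1 C (X \<otimes>\<^bsub>C\<^esub> Y) Z)
      (pairing C (Pr2 C X Y \<cdot>\<^bsub>C\<^esub> Pr1 C (X \<otimes>\<^bsub>C\<^esub> Y) Z) (Pr2 C (X \<otimes>\<^bsub>C\<^esub> Y) Z))"

definition left_unitor :: "('o, 'm, 'x) product_data_scheme \<Rightarrow> 'o \<Rightarrow> 'm" where
  \<comment> \<open>\<open>1 \<otimes> X \<rightarrow> X\<close>\<close>
  "left_unitor C X = Pr2 C (Unit C) X"


section \<open>The category of lenses\<close>

text \<open>A lens \<open>S \<rightarrow> A\<close> is a pair \<open>(get, put)\<close>; its source and target are those of \<open>get\<close>.\<close>

definition lens_comp ::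
  "('o, 'm, 'x) product_data_scheme \<Rightarrow> 'm \<times> 'm \<Rightarrow> 'm \<times> 'm \<Rightarrow> 'm \<times> 'm" where
  "lens_comp C = (\<lambda>(get2, put2) (get1, put1).
    let T = Dom C get1; S = Cod C get1; A = Cod C get2 in
      (get2 \<cdot>\<^bsub>C\<^esub> get1,
       put1 \<cdot>\<^bsub>C\<^esub> (Ident C T \<times>\<^bsub>C\<^esub> put2) \<cdot>\<^bsub>C\<^esub> associator C T S A
         \<cdot>\<^bsub>C\<^esub> (pairing C (Ident C T) get1 \<times>\<^bsub>C\<^esub> Ident C A)))"

definition Lens :: "('o, 'm, 'x) product_data_scheme \<Rightarrow> ('o, 'm \<times> 'm) category_data" where
  "Lens C = \<lparr>
    Obj = Obj C,
    Arr = {(get, put). get \<in> Arr C \<and>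
      put \<in> Hom C (Dom C get \<otimes>\<^bsub>C\<^esub> Cod C get) (Dom C get)},
    Dom = (\<lambda>(get, put). Dom C get),
    Cod = (\<lambda>(get, put). Cod C get),
    Ident = (\<lambda>S. (Ident C S, Pr2 C S S)),
    Comp = lens_comp C\<rparr>"


section \<open>The category of optics\<close>

text \<open>A triple \<open>(M, l, r)\<close> with \<open>l : S \<rightarrow> M \<otimes> A\<close> and \<open>r : M \<otimes> A' \<rightarrow> S'\<close> represents an optic
  \<open>(S, S') \<rightarrow> (A, A')\<close> with residual \<open>M\<close>.\<close>

definition optic_reps ::
  "('o, 'm, 'x) product_data_scheme \<Rightarrow> 'o \<times> 'o \<Rightarrow> 'o \<times> 'o \<Rightarrow> ('o \<times> 'm \<times> 'm) set" where
  "optic_reps C = (\<lambda>(S, S') (A, A'). {(M, l, r). M \<in> Obj C \<and>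
    l \<in> Hom C S (M \<otimes>\<^bsub>C\<^esub> A) \<and> r \<in> Hom C (M \<otimes>\<^bsub>C\<^esub> A') S'})"

inductive optic_step ::
  "('o, 'm, 'x) product_data_scheme \<Rightarrow> 'o \<times> 'o \<Rightarrow> 'o \<times> 'o
    \<Rightarrow> 'o \<times> 'm \<times> 'm \<Rightarrow> 'o \<times> 'm \<times> 'm \<Rightarrow> bool"
  for C X Y where
  "\<lbrakk>f \<in> Hom C M N; l \<in> Hom C (fst X) (M \<otimes>\<^bsub>C\<^esub> fst Y); r \<in> Hom C (N \<otimes>\<^bsub>C\<^esub> snd Y) (snd X)\<rbrakk>
    \<Longrightarrow> optic_step C X Y
      (N, (f \<times>\<^bsub>C\<^esub> Ident C (fst Y)) \<cdot>\<^bsub>C\<^esub> l, r)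
      (M, l, r \<cdot>\<^bsub>C\<^esub> (f \<times>\<^bsub>C\<^esub> Ident C (snd Y)))"

text \<open>The coend \<open>\<integral>\<^sup>M C(S, M \<otimes> A) \<times> C(M \<otimes> A', S')\<close>, as a set of equivalence classes.\<close>

definition optic_coend ::
  "('o, 'm, 'x) product_data_scheme \<Rightarrow> 'o \<times> 'o \<Rightarrow> 'o \<times> 'o \<Rightarrow> ('o \<times> 'm \<times> 'm) set set" where
  "optic_coend C X Y = optic_reps C X Y //
    {(p, q). p \<in> optic_reps C X Y \<and> equivclp (optic_step C X Y) p q}"

text \<open>An equivalence class need not determine \<open>(A, A')\<close>, since \<open>M \<otimes> A\<close> need not determine \<open>A\<close>;
  arrows of the category of optics therefore carry their source and target.\<close>

type_synonym ('o, 'm) optic = "('o \<times> 'o) \<times> ('o \<times> 'o) \<times> ('o \<times> 'm \<times> 'm) set"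

definition optic_class ::
  "('o, 'm, 'x) product_data_scheme \<Rightarrow> 'o \<times> 'o \<Rightarrow> 'o \<times> 'o \<Rightarrow> 'o \<times> 'm \<times> 'm \<Rightarrow> ('o, 'm) optic" where
  "optic_class C X Y p = (X, Y, {q. equivclp (optic_step C X Y) p q})"

definition optic_comp_rep ::
  "('o, 'm, 'x) product_data_scheme \<Rightarrow> 'o \<times> 'o
    \<Rightarrow> 'o \<times> 'm \<times> 'm \<Rightarrow> 'o \<times> 'm \<times> 'm \<Rightarrow> 'o \<times> 'm \<times> 'm" where
  \<comment> \<open>\<open>(B, B')\<close> is the target of the composite, with the arrow applied first as last argument;
    the residual \<open>M \<otimes> N\<close> requires reassociation.\<close>
  "optic_comp_rep C = (\<lambda>(B, B') (N, l, r) (M, l', r').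
    (M \<otimes>\<^bsub>C\<^esub> N,
     inverse_arrow C (associator C M N B) \<cdot>\<^bsub>C\<^esub> (Ident C M \<times>\<^bsub>C\<^esub> l) \<cdot>\<^bsub>C\<^esub> l',
     r' \<cdot>\<^bsub>C\<^esub> (Ident C M \<times>\<^bsub>C\<^esub> r) \<cdot>\<^bsub>C\<^esub> associator C M N B'))"

text \<open>The composite of two classes is the union of the classes of the composites of all
  representatives. That this is again a single class, i.e.\ that composition is well defined,
  is part of the assertion that \<open>Optic C\<close> is a category.\<close>

definition optic_comp ::
  "('o, 'm, 'x) product_data_scheme \<Rightarrow> ('o, 'm) optic \<Rightarrow> ('o, 'm) optic \<Rightarrow> ('o, 'm) optic" where
  "optic_comp C = (\<lambda>(Y', Z, Q) (X, Y, P).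
    (X, Z, {u. \<exists>q\<in>Q. \<exists>p\<in>P. equivclp (optic_step C X Z) (optic_comp_rep C Z q p) u}))"

definition Optic ::
  "('o, 'm, 'x) product_data_scheme \<Rightarrow> ('o \<times> 'o, ('o, 'm) optic) category_data" where
  "Optic C = \<lparr>
    Obj = Obj C \<times> Obj C,
    Arr = {(X, Y, P). X \<in> Obj C \<times> Obj C \<and> Y \<in> Obj C \<times> Obj C \<and> P \<in> optic_coend C X Y},
    Dom = (\<lambda>(X, Y, P). X),
    Cod = (\<lambda>(X, Y, P). Y),
    Ident = (\<lambda>(S, S'). optic_class C (S, S') (S, S')
      (Unit C, inverse_arrow C (left_unitor C S), left_unitor C S')),
    Comp = optic_comp C\<rparr>"

end

theory Submission
  imports Defs
begin

text \<open>Because \<open>\<times>\<close> is cartesian, the left leg of an optic splits as \<open>l = [l\<^sub>1, l\<^sub>2]\<close>, that is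
  \<open>l = (l\<^sub>1 \<times> A) [id, l\<^sub>2]\<close>. Sliding \<open>l\<^sub>1\<close> across the coend gives
  \<open>\<langle>l | r\<rangle> = \<langle>[id, l\<^sub>2] | r (l\<^sub>1 \<times> A')\<rangle>\<close>, an optic with residual \<open>S\<close> determined by
  \<open>l\<^sub>2 : S \<rightarrow> A\<close> and \<open>r (l\<^sub>1 \<times> A') : S \<times> A' \<rightarrow> S'\<close>. Both components are invariant under the
  generating relation, so an optic \<open>(S, S') \<rightarrow> (A, A')\<close> is the same as such a pair. Composing
  these pairs as composites of optics yields a category of lenses with distinct forward and
  backward objects, whose diagonal part is the category of lenses.\<close>

section \<open>Isomorphisms of categories\<close>

lemma cat_isomorphism_sym:
  assumes "cat_isomorphism C D Fo Fa"
  obtains Go Ga where "cat_isomorphism D C Go Ga" "\<And>X. X \<in> Obj C \<Longrightarrow> Go (Fo X) = X"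
  using assms unfolding cat_isomorphism_def by blast

lemma cat_functor_comp:
  assumes "cat_functor C D Fo Fa" "cat_functor D E Go Ga"
  shows "cat_functor C E (Go \<circ> Fo) (Ga \<circ> Fa)"
proof -
  interpret F: cat_functor C D Fo Fa by fact
  interpret G: cat_functor D E Go Ga by fact
  show ?thesis
  proof unfold_locales
    fix f g X Y Z assume fg: "f \<in> Hom C X Y" "g \<in> Hom C Y Z"
    show "(Ga \<circ> Fa) (g \<cdot>\<^bsub>C\<^esub> f) = (Ga \<circ> Fa) g \<cdot>\<^bsub>E\<^esub> (Ga \<circ> Fa) f"
      using F.Fa_Comp[OF fg] G.Fa_Comp[OF F.Fa_in[OF fg(1)] F.Fa_in[OF fg(2)]] by simp
  qed (simp_all add: F.Fo_in G.Fo_in F.Fa_in G.Fa_in F.Fa_Ident G.Fa_Ident)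
qed

lemma cat_isomorphism_trans:
  assumes "cat_isomorphism C D Fo Fa" "cat_isomorphism D E Go Ga"
  shows "cat_isomorphism C E (Go \<circ> Fo) (Ga \<circ> Fa)"
proof -
  from assms(1) obtain Fo' Fa' where F: "cat_functor C D Fo Fa" "cat_functor D C Fo' Fa'"
    "\<forall>X\<in>Obj C. Fo' (Fo X) = X" "\<forall>f\<in>Arr C. Fa' (Fa f) = f"
    "\<forall>Y\<in>Obj D. Fo (Fo' Y) = Y" "\<forall>g\<in>Arr D. Fa (Fa' g) = g"
    unfolding cat_isomorphism_def by blast
  from assms(2) obtain Go' Ga' where G: "cat_functor D E Go Ga" "cat_functor E D Go' Ga'"
    "\<forall>X\<in>Obj D. Go' (Go X) = X" "\<forall>f\<in>Arr D. Ga' (Ga f) = f"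
    "\<forall>Y\<in>Obj E. Go (Go' Y) = Y" "\<forall>g\<in>Arr E. Ga (Ga' g) = g"
    unfolding cat_isomorphism_def by blast
  have Arr: "Fa f \<in> Arr D" if "f \<in> Arr C" for f
    using cat_functor.Fa_in[OF F(1), of f "Dom C f" "Cod C f"] that by (simp add: Hom_def)
  have Arr': "Ga' f \<in> Arr D" if "f \<in> Arr E" for f
    using cat_functor.Fa_in[OF G(2), of f "Dom E f" "Cod E f"] that by (simp add: Hom_def)
  show ?thesis
    unfolding cat_isomorphism_def
    using F G Arr Arr' cat_functor.Fo_in[OF F(1)] cat_functor.Fo_in[OF G(2)]
      cat_functor_comp[OF F(1) G(1)] cat_functor_comp[OF G(2) F(2)]
    by (intro conjI exI[of _ "Fo' \<circ> Go'"] exI[of _ "Fa' \<circ> Ga'"]) auto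
qed

section \<open>Transport of category structure along bijections\<close>

text \<open>Only the source is assumed to be a category. The laws of \<open>D\<close> are then
  inherited, which is how \<open>Lens C\<close> and \<open>Optic C\<close> are shown to be
  categories.\<close>

locale bijective_on_arrows = source: category C
  for C :: "('o1, 'm1, 'x1) category_data_scheme"
    and D :: "('o2, 'm2, 'x2) category_data_scheme"
    and Fo :: "'o1 \<Rightarrow> 'o2" and Fa :: "'m1 \<Rightarrow> 'm2" +
  assumes bij_Obj: "bij_betw Fo (Obj C) (Obj D)"
    and bij_Arr: "bij_betw Fa (Arr C) (Arr D)"
    and Dom_Fa: "f \<in> Arr C \<Longrightarrow> Dom D (Fa f) = Fo (Dom C f)"
    and Cod_Fa: "f \<in> Arr C \<Longrightarrow> Cod D (Fa f) = Fo (Cod C f)"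
    and Ident_Fo: "X \<in> Obj C \<Longrightarrow> Ident D (Fo X) = Fa (Ident C X)"
    and Comp_Fa: "f \<in> Hom C X Y \<Longrightarrow> g \<in> Hom C Y Z \<Longrightarrow> Fa g \<cdot>\<^bsub>D\<^esub> Fa f = Fa (g \<cdot>\<^bsub>C\<^esub> f)"
begin

lemma Fo_in: "X \<in> Obj C \<Longrightarrow> Fo X \<in> Obj D"
  using bij_Obj by (auto simp: bij_betw_def)

lemma Fa_in: "f \<in> Hom C X Y \<Longrightarrow> Fa f \<in> Hom D (Fo X) (Fo Y)"
  using bij_Arr by (auto simp: Hom_def bij_betw_def Dom_Fa Cod_Fa)

lemma Hom_cases:
  assumes "g \<in> Hom D X' Y'"
  obtains f X Y where "f \<in> Hom C X Y" "X \<in> Obj C" "Y \<in> Obj C" "g = Fa f" "X' = Fo X" "Y' = Fo Y"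
proof -
  from assms bij_Arr obtain f where "f \<in> Arr C" "g = Fa f"
    by (auto simp: Hom_def bij_betw_def)
  then show ?thesis
    using assms that[of f "Dom C f" "Cod C f"]
    by (simp add: Hom_def Dom_Fa Cod_Fa source.Dom_in source.Cod_in)
qed

lemma Fo_eqD: "Fo X = Fo Y \<Longrightarrow> X \<in> Obj C \<Longrightarrow> Y \<in> Obj C \<Longrightarrow> X = Y"
  using bij_Obj by (auto simp: bij_betw_def inj_on_def)

text \<open>Every arrow of \<open>D\<close> is an image, and since \<open>Fo\<close> is injective on
  objects, composable arrows of \<open>D\<close> come from composable arrows of \<open>C\<close>.
  Each law is thus the image of the same law in \<open>C\<close>.\<close>

lemma category_target: "category D"
proof
  fix g assume "g \<in> Arr D"
  then have "g \<in> Hom D (Dom D g) (Cod D g)" by (simp add: Hom_def)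
  then show "Dom D g \<in> Obj D" "Cod D g \<in> Obj D"
    by (auto elim!: Hom_cases simp: Fo_in)
next
  fix X' assume "X' \<in> Obj D"
  then obtain X where "X \<in> Obj C" "X' = Fo X" using bij_Obj by (auto simp: bij_betw_def)
  then show "Ident D X' \<in> Hom D X' X'" by (simp add: Ident_Fo Fa_in source.Ident_in)
next
  fix f' g' X' Y' Z' assume "f' \<in> Hom D X' Y'" "g' \<in> Hom D Y' Z'"
  then show "g' \<cdot>\<^bsub>D\<^esub> f' \<in> Hom D X' Z'"
    by (elim Hom_cases) (auto dest!: Fo_eqD simp: Comp_Fa intro!: Fa_in intro: source.Comp_in)
next
  fix f' X' Y' assume "f' \<in> Hom D X' Y'"
  then obtain f X Y where f: "f \<in> Hom C X Y" "X \<in> Obj C" "Y \<in> Obj C"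
    "f' = Fa f" "X' = Fo X" "Y' = Fo Y"
    by (rule Hom_cases)
  then show "f' \<cdot>\<^bsub>D\<^esub> Ident D X' = f'" "Ident D Y' \<cdot>\<^bsub>D\<^esub> f' = f'"
    using Comp_Fa[OF source.Ident_in f(1)] Comp_Fa[OF f(1) source.Ident_in]
    by (simp_all add: Ident_Fo source.Comp_Ident source.Ident_Comp)
next
  fix f' g' h' W' X' Y' Z'
  assume f': "f' \<in> Hom D W' X'" and g': "g' \<in> Hom D X' Y'" and h': "h' \<in> Hom D Y' Z'"
  from f' obtain f W X where f: "f \<in> Hom C W X" "X \<in> Obj C" "f' = Fa f" "X' = Fo X"
    by (rule Hom_cases)
  \<comment> \<open>A preimage of \<open>g'\<close> starts at an object with the same image as
    \<open>X\<close>, hence at \<open>X\<close> itself.\<close>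
  from g' f obtain g Y where g: "g \<in> Hom C X Y" "Y \<in> Obj C" "g' = Fa g" "Y' = Fo Y"
    by (metis Hom_cases Fo_eqD)
  from h' g obtain h Z where h: "h \<in> Hom C Y Z" "h' = Fa h"
    by (metis Hom_cases Fo_eqD)
  show "(h' \<cdot>\<^bsub>D\<^esub> g') \<cdot>\<^bsub>D\<^esub> f' = h' \<cdot>\<^bsub>D\<^esub> (g' \<cdot>\<^bsub>D\<^esub> f')"
    using f g h
    by (simp add: Comp_Fa[OF f(1) g(1)] Comp_Fa[OF g(1) h(1)] Comp_Fa[OF f(1) source.Comp_in[OF g(1) h(1)]]
        Comp_Fa[OF source.Comp_in[OF f(1) g(1)] h(1)] source.Comp_assoc[OF f(1) g(1) h(1)])
qed

lemma cat_isomorphism: "cat_isomorphism C D Fo Fa"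
proof -
  interpret target: category D by (rule category_target)
  define Go Ga where "Go = inv_into (Obj C) Fo" and "Ga = inv_into (Arr C) Fa"
  have Go: "Go (Fo X) = X" if "X \<in> Obj C" for X
    using that bij_Obj unfolding Go_def by (simp add: bij_betw_inv_into_left)
  have Ga: "Ga (Fa f) = f" if "f \<in> Arr C" for f
    using that bij_Arr unfolding Ga_def by (simp add: bij_betw_inv_into_left)
  have Go': "Go Y \<in> Obj C" "Fo (Go Y) = Y" if "Y \<in> Obj D" for Y
    using that bij_Obj bij_betw_inv_into_right[of Fo "Obj C" "Obj D" Y]
    unfolding Go_def by (auto simp: bij_betw_def inv_into_into)
  have Ga': "Fa (Ga g) = g" if "g \<in> Arr D" for g
    using that bij_Arr unfolding Ga_def by (simp add: bij_betw_inv_into_right)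
  have Ga_in: "Ga g \<in> Hom C (Go X) (Go Y)" if "g \<in> Hom D X Y" for g X Y
    using that by (rule Hom_cases) (auto simp: Go Ga Hom_def)
  have "cat_functor C D Fo Fa"
    by unfold_locales (auto simp: Fo_in Fa_in Ident_Fo Comp_Fa)
  moreover have "cat_functor D C Go Ga"
  proof unfold_locales
    fix Y assume "Y \<in> Obj D"
    then show "Go Y \<in> Obj C" "Ga (Ident D Y) = Ident C (Go Y)"
      using Go'[of Y] Ident_Fo[of "Go Y"] Ga[of "Ident C (Go Y)"] source.Ident_in[of "Go Y"]
      by (auto simp: Hom_def)
  next
    fix f g X Y Z assume fg: "f \<in> Hom D X Y" "g \<in> Hom D Y Z"
    have "g \<cdot>\<^bsub>D\<^esub> f = Fa (Ga g \<cdot>\<^bsub>C\<^esub> Ga f)"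
      using Comp_Fa[OF Ga_in[OF fg(1)] Ga_in[OF fg(2)]] fg by (simp add: Ga' Hom_def)
    then show "Ga (g \<cdot>\<^bsub>D\<^esub> f) = Ga g \<cdot>\<^bsub>C\<^esub> Ga f"
      using source.Comp_in[OF Ga_in[OF fg(1)] Ga_in[OF fg(2)]] by (simp add: Ga Hom_def)
  qed (rule Ga_in)
  ultimately show ?thesis
    unfolding cat_isomorphism_def using Go Ga Go' Ga' by blast
qed

end

section \<open>Full subcategories\<close>

lemma Hom_full_subcategory:
  "Hom (full_subcategory C U) X Y = {f \<in> Hom C X Y. X \<in> U \<and> Y \<in> U}"
  by (auto simp: Hom_def full_subcategory_def)

lemma Comp_full_subcategory: "g \<cdot>\<^bsub>full_subcategory C U\<^esub> f = g \<cdot>\<^bsub>C\<^esub> f"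
  by (simp add: full_subcategory_def)

lemma category_full_subcategory:
  assumes "category C"
  shows "category (full_subcategory C U)"
proof -
  interpret category C by fact
  show ?thesis
  proof
    show "f \<in> Arr (full_subcategory C U)
      \<Longrightarrow> Dom (full_subcategory C U) f \<in> Obj (full_subcategory C U)" for f
      by (simp add: full_subcategory_def Dom_in)
    show "f \<in> Arr (full_subcategory C U)
      \<Longrightarrow> Cod (full_subcategory C U) f \<in> Obj (full_subcategory C U)" for f
      by (simp add: full_subcategory_def Cod_in)
    show "X \<in> Obj (full_subcategory C U)
      \<Longrightarrow> Ident (full_subcategory C U) X \<in> Hom (full_subcategory C U) X X" for X
      unfolding Hom_full_subcategory by (simp add: full_subcategory_def Ident_in)
  qed (auto simp: Hom_full_subcategory Comp_full_subcategory Comp_assoc intro: Comp_in,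
      simp_all add: full_subcategory_def Comp_Ident Ident_Comp)
qed

lemma bijective_on_arrows_full_subcategory:
  assumes "bijective_on_arrows C D id Fa"
  shows "bijective_on_arrows (full_subcategory C U) (full_subcategory D U) id Fa"
proof -
  interpret bijective_on_arrows C D id Fa by fact
  \<comment> \<open>As \<open>Fa\<close> preserves endpoints, the preimage of an arrow with
    endpoints in \<open>U\<close> again has its endpoints in \<open>U\<close>.\<close>
  have "bij_betw Fa {f \<in> Arr C. Dom C f \<in> U \<and> Cod C f \<in> U} {f \<in> Arr D. Dom D f \<in> U \<and> Cod D f \<in> U}"
    using bij_Arr unfolding bij_betw_def
    by (auto simp: image_iff Dom_Fa Cod_Fa intro: inj_on_subset) (metis imageE Dom_Fa Cod_Fa id_apply)
  then show ?thesis
    using bij_Obj category_full_subcategory[OF source.category_axioms, of U]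
    by (auto simp: bijective_on_arrows_def bijective_on_arrows_axioms_def Hom_full_subcategory
        Comp_full_subcategory Comp_Fa)
      (auto simp: full_subcategory_def Dom_Fa Cod_Fa Ident_Fo[simplified] bij_betw_def)
qed


section \<open>Finite products\<close>

context category
begin

text \<open>This and the next rules restate the axioms with side conditions on \<open>Arr\<close>,
  \<open>Dom\<close> and \<open>Cod\<close>, which rewriting can compute, whereas \<open>Hom\<close>
  leaves intermediate objects to be guessed.\<close>

lemma Ident_simps [simp]:
  "X \<in> Obj C \<Longrightarrow> Ident C X \<in> Arr C"
  "X \<in> Obj C \<Longrightarrow> Dom C (Ident C X) = X"
  "X \<in> Obj C \<Longrightarrow> Cod C (Ident C X) = X"
  using Ident_in by (auto simp: Hom_def)

lemma Comp_simps [simp]: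
  assumes "f \<in> Arr C" "g \<in> Arr C" "Dom C g = Cod C f"
  shows "g \<cdot> f \<in> Arr C" "Dom C (g \<cdot> f) = Dom C f" "Cod C (g \<cdot> f) = Cod C g"
  using assms Comp_in[of f "Dom C f" "Cod C f" g "Cod C g"] by (auto simp: Hom_def)

lemma Comp_Ident' [simp]: "f \<in> Arr C \<Longrightarrow> Dom C f = X \<Longrightarrow> f \<cdot> Ident C X = f"
  using Comp_Ident[of f X "Cod C f"] by (simp add: Hom_def)

lemma Ident_Comp' [simp]: "f \<in> Arr C \<Longrightarrow> Cod C f = Y \<Longrightarrow> Ident C Y \<cdot> f = f"
  using Ident_Comp[of f "Dom C f" Y] by (simp add: Hom_def)

lemma Comp_assoc' [simp]:
  "\<lbrakk>f \<in> Arr C; g \<in> Arr C; h \<in> Arr C; Dom C g = Cod C f; Dom C h = Cod C g\<rbrakk>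
    \<Longrightarrow> (h \<cdot> g) \<cdot> f = h \<cdot> (g \<cdot> f)"
  using Comp_assoc[of f "Dom C f" "Cod C f" g "Cod C g" h "Cod C h"] by (simp add: Hom_def)

text \<open>Two-sided inverses are unique: \<open>h = h (f g) = (h f) g = g\<close>.\<close>

lemma inverse_arrow_eq:
  assumes f: "f \<in> Hom C X Y" and g: "g \<in> Hom C Y X"
    and gf: "g \<cdot> f = Ident C X" and fg: "f \<cdot> g = Ident C Y"
  shows "inverse_arrow C f = g"
  unfolding inverse_arrow_def
proof (rule the_equality)
  fix h assume h: "h \<in> Hom C (Cod C f) (Dom C f) \<and>
    h \<cdot> f = Ident C (Dom C f) \<and> f \<cdot> h = Ident C (Cod C f)"
  with f have "h \<in> Hom C Y X" by (simp add: Hom_def)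
  with h f g show "h = g"
    using Comp_assoc[of g Y X f Y h X] Comp_Ident[of h Y X] Ident_Comp[of g Y X]
    by (simp add: fg) (simp add: Hom_def)
qed (use assms in \<open>auto simp: Hom_def\<close>)

end

context category_with_finite_products
begin

declare Unit_in [simp] Prod_in [simp] Dom_in [simp] Cod_in [simp]

lemma Pr_simps [simp]:
  assumes "A \<in> Obj C" "B \<in> Obj C"
  shows "Pr1 C A B \<in> Arr C" "Dom C (Pr1 C A B) = A \<otimes> B" "Cod C (Pr1 C A B) = A"
    "Pr2 C A B \<in> Arr C" "Dom C (Pr2 C A B) = A \<otimes> B" "Cod C (Pr2 C A B) = B"
  using Pr1_in[OF assms] Pr2_in[OF assms] by (auto simp: Hom_def)

lemma pairing_props:
  assumes "f \<in> Arr C" "g \<in> Arr C" "Dom C f = Dom C g"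
  shows "pairing C f g \<in> Hom C (Dom C g) (Cod C f \<otimes> Cod C g) \<and>
    Pr1 C (Cod C f) (Cod C g) \<cdot> pairing C f g = f \<and> Pr2 C (Cod C f) (Cod C g) \<cdot> pairing C f g = g"
  using theI'[OF Prod_universal[of f "Dom C g" "Cod C f" g "Cod C g"]] assms
  by (simp add: pairing_def Hom_def)

lemma pairing_simps [simp]:
  assumes "f \<in> Arr C" "g \<in> Arr C" "Dom C f = Dom C g"
  shows "pairing C f g \<in> Arr C" "Dom C (pairing C f g) = Dom C g"
    "Cod C (pairing C f g) = Cod C f \<otimes> Cod C g"
  using pairing_props[OF assms] by (auto simp: Hom_def)

lemma Pr_pairing [simp]:
  assumes "f \<in> Arr C" "g \<in> Arr C" "Dom C f = Dom C g" "Cod C f = A" "Cod C g = B"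
  shows "Pr1 C A B \<cdot> pairing C f g = f" "Pr2 C A B \<cdot> pairing C f g = g"
  using pairing_props[of f g] assms by auto

lemma pairing_eqI:
  assumes "h \<in> Arr C" "k \<in> Arr C" "Dom C h = Dom C k" "Cod C h = A \<otimes> B" "Cod C k = A \<otimes> B"
    "A \<in> Obj C" "B \<in> Obj C"
    and eq: "Pr1 C A B \<cdot> h = Pr1 C A B \<cdot> k" "Pr2 C A B \<cdot> h = Pr2 C A B \<cdot> k"
  shows "h = k"
proof -
  have "\<exists>!u. u \<in> Hom C (Dom C k) (A \<otimes> B) \<and> Pr1 C A B \<cdot> u = Pr1 C A B \<cdot> k \<and> Pr2 C A B \<cdot> u = Pr2 C A B \<cdot> k"
    by (rule Prod_universal) (use assms in \<open>auto simp: Hom_def\<close>)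
  then show ?thesis
    using assms unfolding Hom_def by (metis (mono_tags, lifting) mem_Collect_eq)
qed

text \<open>Pushing composites into pairings, together with \<open>Pr_pairing\<close> and the eta
  rules below, normalises arrows into products. The later identities of lenses and optics are
  checked this way.\<close>

lemma pairing_Comp [simp]:
  assumes "f \<in> Arr C" "g \<in> Arr C" "h \<in> Arr C" "Dom C f = Cod C h" "Dom C g = Cod C h"
  shows "pairing C f g \<cdot> h = pairing C (f \<cdot> h) (g \<cdot> h)"
  by (rule pairing_eqI[of _ _ "Cod C f" "Cod C g"])
    \<comment> \<open>Associating to the left puts each projection directly next to the
      pairing.\<close>
    (use assms in \<open>simp_all flip: Comp_assoc'\<close>)

lemma pairing_Pr_Comp [simp]:
  assumes "h \<in> Arr C" "Cod C h = A \<otimes> B" "A \<in> Obj C" "B \<in> Obj C"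
  shows "pairing C (Pr1 C A B \<cdot> h) (Pr2 C A B \<cdot> h) = h"
  by (rule pairing_eqI[of _ _ A B]) (use assms in simp_all)

lemma pairing_Pr [simp]:
  assumes "A \<in> Obj C" "B \<in> Obj C"
  shows "pairing C (Pr1 C A B) (Pr2 C A B) = Ident C (A \<otimes> B)"
  by (rule pairing_eqI[of _ _ A B]) (use assms in simp_all)

lemma prod_arrow_eq [simp]:
  assumes "f \<in> Arr C" "g \<in> Arr C"
  shows "f \<times>\<^bsub>C\<^esub> g = pairing C (f \<cdot> Pr1 C (Dom C f) (Dom C g)) (g \<cdot> Pr2 C (Dom C f) (Dom C g))"
  by (simp add: prod_arrow_def)

lemma inverse_associator:
  assumes "X \<in> Obj C" "Y \<in> Obj C" "Z \<in> Obj C"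
  shows "inverse_arrow C (associator C X Y Z) =
    pairing C (pairing C (Pr1 C X (Y \<otimes> Z)) (Pr1 C Y Z \<cdot> Pr2 C X (Y \<otimes> Z)))
      (Pr2 C Y Z \<cdot> Pr2 C X (Y \<otimes> Z))"
  by (rule inverse_arrow_eq[of _ "(X \<otimes> Y) \<otimes> Z" "X \<otimes> (Y \<otimes> Z)"])
    (use assms in \<open>simp_all add: associator_def Hom_def\<close>)

lemma inverse_left_unitor:
  assumes "X \<in> Obj C" "t \<in> Hom C X (Unit C)"
  shows "inverse_arrow C (left_unitor C X) = pairing C t (Ident C X)"
proof (rule inverse_arrow_eq[of _ "Unit C \<otimes> X" X])
  have "t \<cdot> Pr2 C (Unit C) X \<in> Hom C (Unit C \<otimes> X) (Unit C)"
    "Pr1 C (Unit C) X \<in> Hom C (Unit C \<otimes> X) (Unit C)"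
    using assms by (simp_all add: Hom_def)
  \<comment> \<open>Both sides are arrows into the terminal object.\<close>
  then have "t \<cdot> Pr2 C (Unit C) X = Pr1 C (Unit C) X"
    using Unit_terminal[of "Unit C \<otimes> X"] assms(1) Unit_in Prod_in by blast
  then show "pairing C t (Ident C X) \<cdot> left_unitor C X = Ident C (Unit C \<otimes> X)"
    using assms by (simp add: left_unitor_def Hom_def)
qed (use assms in \<open>simp_all add: left_unitor_def Hom_def\<close>)

end


section \<open>Bimorphic lenses\<close>

text \<open>On generalized elements the second component is
  \<open>(t, a') |-> put1 (t, put2 (get1 t, a'))\<close>. The endpoints are passed explicitly
  because the arrows need not determine \<open>A'\<close>.\<close>

definition bilens_comp ::
  "('o, 'm, 'x) product_data_scheme \<Rightarrow> 'o \<times> 'o \<Rightarrow> 'o \<times> 'o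
    \<Rightarrow> 'm \<times> 'm \<Rightarrow> 'm \<times> 'm \<Rightarrow> 'm \<times> 'm" where
  "bilens_comp C = (\<lambda>(T, T') (A, A') (get2, put2) (get1, put1).
    (get2 \<cdot>\<^bsub>C\<^esub> get1,
     put1 \<cdot>\<^bsub>C\<^esub> pairing C (Pr1 C T A')
       (put2 \<cdot>\<^bsub>C\<^esub> pairing C (get1 \<cdot>\<^bsub>C\<^esub> Pr1 C T A') (Pr2 C T A'))))"

definition bilenses ::
  "('o, 'm, 'x) product_data_scheme \<Rightarrow> 'o \<times> 'o \<Rightarrow> 'o \<times> 'o \<Rightarrow> ('m \<times> 'm) set" where
  "bilenses C = (\<lambda>(S, S') (A, A'). Hom C S A \<times> Hom C (S \<otimes>\<^bsub>C\<^esub> A') S')"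

definition Bilens ::
  "('o, 'm, 'x) product_data_scheme \<Rightarrow>
    ('o \<times> 'o, ('o \<times> 'o) \<times> ('o \<times> 'o) \<times> 'm \<times> 'm) category_data" where
  "Bilens C = \<lparr>
    Obj = Obj C \<times> Obj C,
    Arr = {(X, Y, p). X \<in> Obj C \<times> Obj C \<and> Y \<in> Obj C \<times> Obj C \<and> p \<in> bilenses C X Y},
    Dom = (\<lambda>(X, Y, p). X),
    Cod = (\<lambda>(X, Y, p). Y),
    Ident = (\<lambda>(S, S'). ((S, S'), (S, S'), Ident C S, Pr2 C S S')),
    Comp = (\<lambda>(Y', Z, q) (X, Y, p). (X, Z, bilens_comp C X Z q p))\<rparr>"

definition bilens_of_rep ::
  "('o, 'm, 'x) product_data_scheme \<Rightarrow> 'o \<times> 'o \<Rightarrow> 'o \<times> 'm \<times> 'm \<Rightarrow> 'm \<times> 'm" where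
  "bilens_of_rep C = (\<lambda>(A, A') (M, l, r).
    (Pr2 C M A \<cdot>\<^bsub>C\<^esub> l, r \<cdot>\<^bsub>C\<^esub> ((Pr1 C M A \<cdot>\<^bsub>C\<^esub> l) \<times>\<^bsub>C\<^esub> Ident C A')))"

text \<open>The canonical representative: its residual is the source \<open>S\<close>, and its left
  leg is the graph of \<open>get\<close>.\<close>

definition rep_of_bilens ::
  "('o, 'm, 'x) product_data_scheme \<Rightarrow> 'o \<times> 'o \<Rightarrow> 'm \<times> 'm \<Rightarrow> 'o \<times> 'm \<times> 'm" where
  "rep_of_bilens C = (\<lambda>(S, S') (get, put). (S, pairing C (Ident C S) get, put))"

text \<open>Taking the whole fibre of \<open>bilens_of_rep\<close> avoids a choice of
  representative; the fibres turn out to be the equivalence classes.\<close>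

definition optic_of_bilens ::
  "('o, 'm, 'x) product_data_scheme \<Rightarrow> ('o \<times> 'o) \<times> ('o \<times> 'o) \<times> 'm \<times> 'm \<Rightarrow> ('o, 'm) optic" where
  "optic_of_bilens C = (\<lambda>(X, Y, p). (X, Y, {q \<in> optic_reps C X Y. bilens_of_rep C Y q = p}))"

context category_with_finite_products
begin

text \<open>For associativity, both bracketings have backward part \<open>(t, a') |-> put1 (t, put2
  (get1 t, put3 (get2 (get1 t), a')))\<close>.\<close>

lemma category_Bilens: "category (Bilens C)"
  by unfold_locales
    (auto simp: Bilens_def Hom_def bilenses_def bilens_comp_def)

text \<open>On the diagonal both endpoints can be read off from \<open>get\<close>, so forgetting
  them loses nothing, and \<open>lens_comp\<close> normalises to \<open>bilens_comp\<close>.\<close>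

lemma bijective_on_arrows_Lens:
  "bijective_on_arrows (full_subcategory (Bilens C) {(S, S) | S. S \<in> Obj C}) (Lens C)
    fst (\<lambda>(X, Y, p). p)"
proof -
  let ?B = "full_subcategory (Bilens C) {(S, S) | S. S \<in> Obj C}"
  interpret category ?B
    by (rule category_full_subcategory[OF category_Bilens])
  show ?thesis
  proof unfold_locales
    show "bij_betw fst (Obj ?B) (Obj (Lens C))"
      by (rule bij_betw_byWitness[where f' = "\<lambda>S. (S, S)"])
        (auto simp: Bilens_def Lens_def full_subcategory_def)
    show "bij_betw (\<lambda>(X, Y, p). p) (Arr ?B) (Arr (Lens C))"
      by (rule bij_betw_byWitness[where f' = "\<lambda>(get, put).
            ((Dom C get, Dom C get), (Cod C get, Cod C get), get, put)"])
        (auto simp: Bilens_def Lens_def full_subcategory_def Hom_def bilenses_def)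
  qed (auto simp: Bilens_def Lens_def full_subcategory_def Hom_def bilenses_def
      bilens_comp_def lens_comp_def associator_def Let_def)
qed


section \<open>Optics as bimorphic lenses\<close>

text \<open>Composing \<open>l\<close> with \<open>f\<close> times the identity leaves its second
  component unchanged and turns the first, \<open>l1\<close>, into \<open>f l1\<close>; this
  \<open>f\<close> is exactly the one that the other side absorbs into \<open>r\<close>.\<close>

lemma optic_step_invariant:
  assumes "optic_step C X Y p q" "X \<in> Obj C \<times> Obj C" "Y \<in> Obj C \<times> Obj C"
  shows "p \<in> optic_reps C X Y \<and> q \<in> optic_reps C X Y \<and> bilens_of_rep C Y p = bilens_of_rep C Y q"
  using assms(1)
proof cases
  case (1 f M N l r)
  then show ?thesis
    using assms(2,3) by (auto simp: optic_reps_def bilens_of_rep_def Hom_def)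
qed

lemma equivclp_optic_step_invariant:
  assumes "equivclp (optic_step C X Y) p q" "X \<in> Obj C \<times> Obj C" "Y \<in> Obj C \<times> Obj C"
    "p \<in> optic_reps C X Y"
  shows "q \<in> optic_reps C X Y \<and> bilens_of_rep C Y q = bilens_of_rep C Y p"
  using assms(1)
  by (induction rule: equivclp_induct)
    (use assms in \<open>auto dest!: optic_step_invariant\<close>)

lemma bilens_of_rep_in:
  assumes "X \<in> Obj C \<times> Obj C" "Y \<in> Obj C \<times> Obj C" "p \<in> optic_reps C X Y"
  shows "bilens_of_rep C Y p \<in> bilenses C X Y"
  using assms by (auto simp: optic_reps_def bilens_of_rep_def bilenses_def Hom_def)

lemma rep_of_bilens_in:
  assumes "X \<in> Obj C \<times> Obj C" "Y \<in> Obj C \<times> Obj C" "p \<in> bilenses C X Y"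
  shows "rep_of_bilens C X p \<in> optic_reps C X Y"
    and "bilens_of_rep C Y (rep_of_bilens C X p) = p"
  using assms
  by (auto simp: optic_reps_def rep_of_bilens_def bilens_of_rep_def bilenses_def Hom_def)

lemma optic_step_rep_of_bilens:
  assumes "X \<in> Obj C \<times> Obj C" "Y \<in> Obj C \<times> Obj C" "p \<in> optic_reps C X Y"
  shows "optic_step C X Y p (rep_of_bilens C X (bilens_of_rep C Y p))"
proof -
  obtain S S' A A' M l r where eq: "X = (S, S')" "Y = (A, A')" "p = (M, l, r)"
    by (metis prod.exhaust)
  with assms have objs: "S \<in> Obj C" "S' \<in> Obj C" "A \<in> Obj C" "A' \<in> Obj C" "M \<in> Obj C"
    and l: "l \<in> Arr C" "Dom C l = S" "Cod C l = M \<otimes> A"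
    and r: "r \<in> Hom C (M \<otimes> A') S'"
    by (auto simp: optic_reps_def Hom_def)
  \<comment> \<open>The slide is along the first component \<open>?f : S -> M\<close>. The left leg
    of the source of the step is \<open>l\<close> again, since \<open>?f\<close> times the identity
    after \<open>?g\<close> has the components of \<open>l\<close>.\<close>
  let ?f = "Pr1 C M A \<cdot> l" and ?g = "pairing C (Ident C S) (Pr2 C M A \<cdot> l)"
  have "optic_step C X Y (M, (?f \<times>\<^bsub>C\<^esub> Ident C (fst Y)) \<cdot> ?g, r)
      (S, ?g, r \<cdot> (?f \<times>\<^bsub>C\<^esub> Ident C (snd Y)))"
    by (rule optic_step.intros) (use eq objs l r in \<open>auto simp: Hom_def\<close>)
  then show ?thesis
    using eq objs l by (simp add: rep_of_bilens_def bilens_of_rep_def)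
qed

text \<open>Representatives with equal image under \<open>bilens_of_rep\<close> both step to the
  same canonical representative; the converse is invariance.\<close>

lemma equivclp_optic_step_iff:
  assumes "X \<in> Obj C \<times> Obj C" "Y \<in> Obj C \<times> Obj C" "p \<in> optic_reps C X Y"
  shows "equivclp (optic_step C X Y) p q \<longleftrightarrow>
    q \<in> optic_reps C X Y \<and> bilens_of_rep C Y q = bilens_of_rep C Y p"
proof
  assume "q \<in> optic_reps C X Y \<and> bilens_of_rep C Y q = bilens_of_rep C Y p"
  then show "equivclp (optic_step C X Y) p q"
    using assms optic_step_rep_of_bilens[of X Y]
    by (metis equivclp_sym equivclp_trans r_into_equivclp)
qed (use assms equivclp_optic_step_invariant in blast)

text \<open>Classes are fibres of \<open>bilens_of_rep\<close>, and every bimorphic lens has a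
  nonempty fibre because \<open>rep_of_bilens\<close> is a section.\<close>

lemma optic_coend_eq:
  assumes "X \<in> Obj C \<times> Obj C" "Y \<in> Obj C \<times> Obj C"
  shows "optic_coend C X Y =
    (\<lambda>p. {q \<in> optic_reps C X Y. bilens_of_rep C Y q = p}) ` bilenses C X Y"
proof -
  have "{(p, q). p \<in> optic_reps C X Y \<and> equivclp (optic_step C X Y) p q} `` {p} =
      {q \<in> optic_reps C X Y. bilens_of_rep C Y q = bilens_of_rep C Y p}"
    if "p \<in> optic_reps C X Y" for p
    using that assms by (auto simp: equivclp_optic_step_iff)
  then have "optic_coend C X Y =
    (\<lambda>p. {q \<in> optic_reps C X Y. bilens_of_rep C Y q = bilens_of_rep C Y p}) ` optic_reps C X Y"
    unfolding optic_coend_def quotient_def by auto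
  also have "\<dots> = (\<lambda>p. {q \<in> optic_reps C X Y. bilens_of_rep C Y q = p})
      ` bilens_of_rep C Y ` optic_reps C X Y"
    by (simp add: image_image)
  also have "bilens_of_rep C Y ` optic_reps C X Y = bilenses C X Y"
  proof (intro equalityI subsetI)
    fix p assume p: "p \<in> bilenses C X Y"
    show "p \<in> bilens_of_rep C Y ` optic_reps C X Y"
      using rep_of_bilens_in[OF assms p] by (metis imageI)
  qed (use assms bilens_of_rep_in in blast)
  finally show ?thesis .
qed

section \<open>Composition and identities of optics\<close>

text \<open>If \<open>l'\<close> sends \<open>t\<close> to \<open>(m, s)\<close> and
  \<open>l\<close> sends \<open>s\<close> to \<open>(n, b)\<close>, the composite has forward value
  \<open>b\<close> and backward part \<open>(t, b') |-> r' (m, r (n, b'))\<close>, which is the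
  composite of the two bimorphic lenses.\<close>

lemma optic_comp_rep_in:
  assumes "X \<in> Obj C \<times> Obj C" "Y \<in> Obj C \<times> Obj C" "Z \<in> Obj C \<times> Obj C"
    "p \<in> optic_reps C X Y" "q \<in> optic_reps C Y Z"
  shows "optic_comp_rep C Z q p \<in> optic_reps C X Z"
    and "bilens_of_rep C Z (optic_comp_rep C Z q p) =
      bilens_comp C X Z (bilens_of_rep C Z q) (bilens_of_rep C Y p)"
  using assms
  by (auto simp: optic_reps_def optic_comp_rep_def bilens_of_rep_def bilens_comp_def Hom_def
      associator_def inverse_associator[unfolded associator_def])

lemma optic_comp_optic_of_bilens:
  assumes "X \<in> Obj C \<times> Obj C" "Y \<in> Obj C \<times> Obj C" "Z \<in> Obj C \<times> Obj C"
    "p \<in> bilenses C X Y" "q \<in> bilenses C Y Z"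
  shows "optic_comp C (optic_of_bilens C (Y, Z, q)) (optic_of_bilens C (X, Y, p)) =
    optic_of_bilens C (X, Z, bilens_comp C X Z q p)"
proof -
  have "equivclp (optic_step C X Z) (optic_comp_rep C Z q' p') u \<longleftrightarrow>
      u \<in> optic_reps C X Z \<and> bilens_of_rep C Z u = bilens_comp C X Z q p"
    if "p' \<in> optic_reps C X Y" "bilens_of_rep C Y p' = p"
      "q' \<in> optic_reps C Y Z" "bilens_of_rep C Z q' = q" for p' q' u
    using that assms by (simp add: equivclp_optic_step_iff optic_comp_rep_in)
  then have "{u. \<exists>q'\<in>{q' \<in> optic_reps C Y Z. bilens_of_rep C Z q' = q}.
        \<exists>p'\<in>{p' \<in> optic_reps C X Y. bilens_of_rep C Y p' = p}.
        equivclp (optic_step C X Z) (optic_comp_rep C Z q' p') u} =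
      {u \<in> optic_reps C X Z. bilens_of_rep C Z u = bilens_comp C X Z q p}"
    \<comment> \<open>All pairs of representatives contribute the same class. The canonical ones
      show that at least one pair exists, so the union is not empty.\<close>
    using rep_of_bilens_in[OF assms(1,2,4)] rep_of_bilens_in[OF assms(2,3,5)] by blast
  then show ?thesis
    by (simp add: optic_comp_def optic_of_bilens_def)
qed

lemma optic_class_Ident:
  assumes "S \<in> Obj C" "S' \<in> Obj C"
  shows "optic_class C (S, S') (S, S') (Unit C, inverse_arrow C (left_unitor C S), left_unitor C S') =
    optic_of_bilens C ((S, S'), (S, S'), Ident C S, Pr2 C S S')"
proof -
  let ?p = "(Unit C, inverse_arrow C (left_unitor C S), left_unitor C S')"
  obtain t where t: "t \<in> Hom C S (Unit C)" using Unit_terminal assms by blast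
  have "?p \<in> optic_reps C (S, S') (S, S')"
      "bilens_of_rep C (S, S') ?p = (Ident C S, Pr2 C S S')"
    unfolding inverse_left_unitor[OF assms(1) t]
    using assms t by (simp_all add: optic_reps_def bilens_of_rep_def left_unitor_def Hom_def)
  then show ?thesis
    using assms by (simp add: optic_class_def optic_of_bilens_def equivclp_optic_step_iff)
qed

lemma bijective_on_arrows_Optic:
  "bijective_on_arrows (Bilens C) (Optic C) id (optic_of_bilens C)"
proof -
  interpret category "Bilens C" by (rule category_Bilens)
  show ?thesis
  proof unfold_locales
    have "inj_on (optic_of_bilens C) (Arr (Bilens C))"
    proof (rule inj_onI)
      fix a b assume "a \<in> Arr (Bilens C)" "b \<in> Arr (Bilens C)"
        and eq: "optic_of_bilens C a = optic_of_bilens C b"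
      moreover obtain X Y p where a: "a = (X, Y, p)" by (cases a)
      moreover obtain X' Y' p' where b: "b = (X', Y', p')" by (cases b)
      ultimately have *: "X \<in> Obj C \<times> Obj C" "Y \<in> Obj C \<times> Obj C" "p \<in> bilenses C X Y"
        "X' = X" "Y' = Y"
        "{q \<in> optic_reps C X Y. bilens_of_rep C Y q = p} =
         {q \<in> optic_reps C X Y. bilens_of_rep C Y q = p'}"
        by (auto simp: Bilens_def optic_of_bilens_def)
      \<comment> \<open>Equal fibres share the canonical representative of \<open>p\<close>, whose
        associated bimorphic lens is therefore both \<open>p\<close> and \<open>p'\<close>.\<close>
      have "rep_of_bilens C X p \<in> {q \<in> optic_reps C X Y. bilens_of_rep C Y q = p'}"
        unfolding *(6)[symmetric] using rep_of_bilens_in[OF *(1-3)] by simp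
      then show "a = b"
        using rep_of_bilens_in(2)[OF *(1-3)] a b * by simp
    qed
    moreover have "optic_of_bilens C ` Arr (Bilens C) = Arr (Optic C)"
    proof (intro equalityI subsetI)
      fix u assume "u \<in> Arr (Optic C)"
      then obtain X Y p where "X \<in> Obj C \<times> Obj C" "Y \<in> Obj C \<times> Obj C" "p \<in> bilenses C X Y"
        "u = optic_of_bilens C (X, Y, p)"
        by (cases u) (auto simp: Optic_def optic_of_bilens_def optic_coend_eq)
      then show "u \<in> optic_of_bilens C ` Arr (Bilens C)"
        by (simp add: Bilens_def)
    next
      fix u assume "u \<in> optic_of_bilens C ` Arr (Bilens C)"
      then show "u \<in> Arr (Optic C)"
        by (auto simp: Bilens_def Optic_def optic_of_bilens_def optic_coend_eq)
    qed
    ultimately show "bij_betw (optic_of_bilens C) (Arr (Bilens C)) (Arr (Optic C))"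
      by (simp add: bij_betw_def)
  next
    fix f g X Y Z assume "f \<in> Hom (Bilens C) X Y" "g \<in> Hom (Bilens C) Y Z"
    then show "optic_of_bilens C g \<cdot>\<^bsub>Optic C\<^esub> optic_of_bilens C f =
        optic_of_bilens C (g \<cdot>\<^bsub>Bilens C\<^esub> f)"
      by (auto simp: Hom_def Bilens_def Optic_def optic_comp_optic_of_bilens)
  qed (auto simp: Bilens_def Optic_def optic_class_Ident, auto simp: optic_of_bilens_def)
qed

end

section \<open>Comparison of diagonal optics with lenses\<close>

theorem proposition2p0p4:
  fixes C :: "('o, 'm, 'x) product_data_scheme"
  assumes "category_with_finite_products C"
  shows "category (Optic C) \<and> category (Lens C) \<and>
    (\<exists>Fo Fa. cat_isomorphism (full_subcategory (Optic C) {(S, S) | S. S \<in> Obj C}) (Lens C) Fo Fa \<and>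
      (\<forall>S\<in>Obj C. Fo (S, S) = S))"
proof -
  interpret category_with_finite_products C by fact
  let ?U = "{(S, S) | S. S \<in> Obj C}"
  have optic: "cat_isomorphism (full_subcategory (Bilens C) ?U) (full_subcategory (Optic C) ?U)
      id (optic_of_bilens C)"
    by (rule bijective_on_arrows.cat_isomorphism
        [OF bijective_on_arrows_full_subcategory[OF bijective_on_arrows_Optic]])
  \<comment> \<open>The isomorphism built so far starts at bimorphic lenses, so it is inverted
    before passing on to \<open>Lens C\<close>.\<close>
  obtain Go Ga where "cat_isomorphism (full_subcategory (Optic C) ?U) (full_subcategory (Bilens C) ?U) Go Ga"
    and Go: "\<And>X. X \<in> Obj (full_subcategory (Bilens C) ?U) \<Longrightarrow> Go (id X) = X"
    using cat_isomorphism_sym[OF optic] by blast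
  then have "cat_isomorphism (full_subcategory (Optic C) ?U) (Lens C) (fst \<circ> Go) ((\<lambda>(X, Y, p). p) \<circ> Ga)"
    using cat_isomorphism_trans bijective_on_arrows.cat_isomorphism[OF bijective_on_arrows_Lens] by blast
  moreover have "\<forall>S\<in>Obj C. (fst \<circ> Go) (S, S) = S"
    using Go by (simp add: full_subcategory_def Bilens_def)
  ultimately show ?thesis
    using bijective_on_arrows.category_target[OF bijective_on_arrows_Optic]
      bijective_on_arrows.category_target[OF bijective_on_arrows_Lens] by blast
qed

end
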